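(* Let $G$ be a $7$-regular graph and let $uv\in E(G)$ be an edge with exactly six common neighbours, i.e. $|N(u)\cap N(v)|=6$. Then the vertex set $\{u,v\}$ is reducible in $G$.
   Context: All graphs are finite, simple and undirected; $N(x)$ is the open neighbourhood of $x$. For a set $S$ of triangles, an $S$-edge is an edge of some triangle in $S$. A nonempty set $V_0\subseteq V(G)$ is reducible (in $G$) if there exist a set $S$ of pairwise edge-disjoint triangles in $G$ and a set $X$ of edges of $G$ such that: (i) $|X|\le 2|S|$; (ii) $G-X$ (the graph $G$ with the edges of $X$ deleted) has no triangle containing a vertex of $V_0$; and (iii) $X$ contains every $S$-edge whose endpoints are both outside $V_0$. *)

theory Defs
  imports Main
begin

(* A graph is given by its vertex set V and its edge set E, an edge being the two-element set of
   its endpoints. *)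

definition simple_graph :: "'a set \<Rightarrow> 'a set set \<Rightarrow> bool" where
  "simple_graph V E \<longleftrightarrow> finite V \<and> (\<forall>e\<in>E. e \<subseteq> V \<and> card e = 2)"

definition nbhd :: "'a set set \<Rightarrow> 'a \<Rightarrow> 'a set" where
  "nbhd E x = {y. {x, y} \<in> E}"

definition regular_graph :: "nat \<Rightarrow> 'a set \<Rightarrow> 'a set set \<Rightarrow> bool" where
  "regular_graph d V E \<longleftrightarrow> simple_graph V E \<and> (\<forall>x\<in>V. card (nbhd E x) = d)"

(* A triangle is represented by the set of its three vertices. *)

definition triangle_edges :: "'a set \<Rightarrow> 'a set set" where
  "triangle_edges T = {e. e \<subseteq> T \<and> card e = 2}"

definition triangles :: "'a set set \<Rightarrow> 'a set set" where
  "triangles E = {T. card T = 3 \<and> triangle_edges T \<subseteq> E}"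

definition edge_disjoint :: "'a set set \<Rightarrow> bool" where
  "edge_disjoint S \<longleftrightarrow>
     (\<forall>T\<in>S. \<forall>T'\<in>S. T \<noteq> T' \<longrightarrow> triangle_edges T \<inter> triangle_edges T' = {})"

definition S_edges :: "'a set set \<Rightarrow> 'a set set" where
  "S_edges S = (\<Union>T\<in>S. triangle_edges T)"

(* For a simple graph (V, E), the sets S and X below are automatically finite, so card is the
   true cardinality. *)

definition reducible :: "'a set \<Rightarrow> 'a set set \<Rightarrow> 'a set \<Rightarrow> bool" where
  "reducible V E V\<^sub>0 \<longleftrightarrow> V\<^sub>0 \<noteq> {} \<and> V\<^sub>0 \<subseteq> V \<and>
     (\<exists>S X. S \<subseteq> triangles E \<and> edge_disjoint S \<and> X \<subseteq> E \<and>
        card X \<le> 2 * card S \<and>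
        (\<forall>T\<in>triangles (E - X). T \<inter> V\<^sub>0 = {}) \<and>
        (\<forall>e\<in>S_edges S. e \<inter> V\<^sub>0 = {} \<longrightarrow> e \<in> X))"

end

theory Submission
  imports Defs
begin

text \<open>
  Put \<open>W = N(u) \<inter> N(v)\<close>, a set of six vertices, and let \<open>H\<close> be the set of edges inside \<open>W\<close>.
  Deleting \<open>X = {uv} \<union> H\<close> destroys all triangles through \<open>u\<close> or \<open>v\<close>, and \<open>X\<close> contains every edge
  inside \<open>W\<close>. So it suffices to find \<open>m + 1\<close> edge-disjoint triangles inside \<open>W \<union> {u, v}\<close> when \<open>H\<close>
  has \<open>2m\<close> or \<open>2m + 1\<close> edges; in the second case one edge is dropped. A triangle \<open>uab\<close> or \<open>vab\<close>
  uses one edge of \<open>H\<close>; thus two disjoint matchings of \<open>H\<close> yield a triangle for each of their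
  edges, and \<open>uvw\<close> may be added if both miss \<open>w\<close>. Accordingly \<open>H\<close> is searched for a six-cycle, or
  for a path, a four-cycle or a few disjoint edges missing a vertex, together with edge-disjoint
  triangles of \<open>H\<close> in the dense cases. That one of these configurations exists is a finite check:
  the average degree in \<open>H\<close> is \<open>2m/3\<close>, so label a vertex of degree \<open>d \<le> 2m/3\<close> by \<open>0\<close> and its
  neighbours by \<open>1, \<dots>, d\<close>; then at most \<open>10 + d - 2m\<close> of the ten pairs of the remaining labels are
  non-edges, and no set of that size meets all configurations of a suitable list.
\<close>

section \<open>Families that small sets cannot meet\<close>

text \<open>
  A sufficient test that no set with at most \<open>b\<close> elements meets all members of the family: branch on
  whether such a set contains the first element of the first member.
\<close>

function unavoidable :: "nat \<Rightarrow> 'a list list \<Rightarrow> bool" where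
  "unavoidable b [] = False"
| "unavoidable b ([] # Fs) = True"
| "unavoidable b ((e # F) # Fs) =
     ((b = 0 \<or> unavoidable (b - 1) (filter (\<lambda>G. e \<notin> set G) Fs)) \<and>
      unavoidable b (F # map (removeAll e) Fs))"
  by pat_completeness auto
termination
proof (relation "measure (\<lambda>(b, Fs). \<Sum>F\<leftarrow>Fs. Suc (length F))", simp, goal_cases)
  case (1 b e F Fs)
  have "(\<Sum>F\<leftarrow>filter P Fs. Suc (length F)) \<le> (\<Sum>F\<leftarrow>Fs. Suc (length F))" for P :: "'a list \<Rightarrow> bool"
    by (induction Fs) auto
  from this[of "\<lambda>G. e \<notin> set G"] show ?case by simp
next
  case (2 b e F Fs)
  have "(\<Sum>F\<leftarrow>map (removeAll e) Fs. Suc (length F)) \<le> (\<Sum>F\<leftarrow>Fs. Suc (length F))"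
    by (induction Fs) (auto intro!: add_mono simp: length_removeAll_less_eq)
  then show ?case by auto
qed

text \<open>If \<open>e\<close> lies in \<open>N\<close>, a member without \<open>e\<close> need
  only avoid \<open>N - {e}\<close>, which costs one unit of \<open>b\<close>; otherwise
  \<open>e\<close> may be erased from every member.\<close>

lemma unavoidable_avoids:
  "unavoidable b Fs \<Longrightarrow> finite N \<Longrightarrow> card N \<le> b \<Longrightarrow> \<exists>F\<in>set Fs. set F \<inter> N = {}"
proof (induction b Fs arbitrary: N rule: unavoidable.induct)
  case (3 b e F Fs)
  show ?case
  proof (cases "e \<in> N")
    case True
    with "3.prems" have "b \<noteq> 0" by (metis card_gt_0_iff empty_iff not_le)
    moreover have "card (N - {e}) \<le> b - 1" using True 3 by auto
    ultimately obtain G where "G \<in> set Fs" "e \<notin> set G" "set G \<inter> (N - {e}) = {}"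
      using "3.IH"(1)[of "N - {e}"] "3.prems" by auto
    then show ?thesis by auto
  next
    case False
    with "3.IH"(2) "3.prems" obtain G where "G \<in> set (F # map (removeAll e) Fs)" "set G \<inter> N = {}"
      by (meson unavoidable.simps(3))
    then consider "set F \<inter> N = {}" | G' where "G' \<in> set Fs" "(set G' - {e}) \<inter> N = {}" by auto
    then show ?thesis using False by cases auto
  qed
qed auto

section \<open>Labelled packings of triangles\<close>

text \<open>
  A packing is a list of triangles on the labels \<open>0, \<dots>, 7\<close>; the labels \<open>0, \<dots>, 5\<close> stand for the
  common neighbours, \<open>6\<close> for \<open>u\<close> and \<open>7\<close> for \<open>v\<close>.
\<close>

definition packing :: "nat list list \<Rightarrow> bool" where
  "packing ts \<longleftrightarrow> list_all (\<lambda>T. length T = 3 \<and> distinct T \<and> list_all (\<lambda>i. i < 8) T) ts \<and>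
     sorted_wrt (\<lambda>T T'. length (filter (\<lambda>i. i \<in> set T) T') \<le> 1) ts"

text \<open>These are the edges a packing demands of H; all pairs involving 6 or 7 are edges
  anyway.\<close>

definition inner_edges :: "nat list list \<Rightarrow> (nat \<times> nat) list" where
  "inner_edges ts =
     concat (map (\<lambda>T. filter (\<lambda>(i, j). i < j \<and> j < 6) (List.product T T)) ts)"

text \<open>Places label i < 6 of a configuration at \<open>p ! i\<close>; the appended entries fix
  the labels of u and v.\<close>

definition relabel :: "nat list list \<Rightarrow> nat list \<Rightarrow> nat list list" where
  "relabel ts p = map (map (\<lambda>i. (p @ [6, 7]) ! i)) ts"

lemma mem_inner_edges:
  "(i, j) \<in> set (inner_edges ts) \<longleftrightarrow> i < j \<and> j < 6 \<and> (\<exists>T\<in>set ts. i \<in> set T \<and> j \<in> set T)"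
  by (auto simp: inner_edges_def)

lemma edge_disjointI:
  assumes "\<And>T T'. T \<in> S \<Longrightarrow> T' \<in> S \<Longrightarrow> T \<noteq> T' \<Longrightarrow> finite T \<and> card (T \<inter> T') \<le> 1"
  shows "edge_disjoint S"
  unfolding edge_disjoint_def
proof (intro ballI impI)
  fix T T' assume T: "T \<in> S" "T' \<in> S" "T \<noteq> T'"
  show "triangle_edges T \<inter> triangle_edges T' = {}"
  proof (rule ccontr)
    assume "triangle_edges T \<inter> triangle_edges T' \<noteq> {}"
    then obtain e where "e \<subseteq> T \<inter> T'" "card e = 2" by (auto simp: triangle_edges_def)
    with assms[OF T] show False using card_mono[of "T \<inter> T'" e] by auto
  qed
qed

lemma packing_triangles:
  assumes "packing ts" and inj: "inj_on z {..<8}"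
    and inner: "\<And>i j. (i, j) \<in> set (inner_edges ts) \<Longrightarrow> {z i, z j} \<in> E"
    and outer: "\<And>i. i < 6 \<Longrightarrow> {z i, z 6} \<in> E" "\<And>i. i < 6 \<Longrightarrow> {z i, z 7} \<in> E" "{z 6, z 7} \<in> E"
  obtains S where "S \<subseteq> triangles E" "edge_disjoint S" "card S = length ts"
    "\<And>T. T \<in> S \<Longrightarrow> T \<subseteq> z ` {..<8}"
proof
  let ?f = "\<lambda>T. z ` set T"
  have T: "card (set T) = 3" "set T \<subseteq> {..<8}" if "T \<in> set ts" for T
    using assms(1) that distinct_card[of T] by (auto simp: packing_def list_all_iff)
  have meet: "card (set (ts ! k) \<inter> set (ts ! l)) \<le> 1"
    if kl: "k < l" "l < length ts" for k l
  proof -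
    have "set (ts ! k) \<inter> set (ts ! l) = set (filter (\<lambda>i. i \<in> set (ts ! k)) (ts ! l))" by auto
    moreover have "length (filter (\<lambda>i. i \<in> set (ts ! k)) (ts ! l)) \<le> 1"
      using assms(1) kl by (simp add: packing_def sorted_wrt_iff_nth_less)
    ultimately show ?thesis using card_length[of "filter (\<lambda>i. i \<in> set (ts ! k)) (ts ! l)"] by simp
  qed
  have meet': "card (set (ts ! k) \<inter> set (ts ! l)) \<le> 1"
    if "k \<noteq> l" "k < length ts" "l < length ts" for k l
    using that meet[of k l] meet[of l k] by (cases "k < l") (auto simp: Int_commute)
  have f_meet: "card (?f (ts ! k) \<inter> ?f (ts ! l)) \<le> 1"
    if "k \<noteq> l" "k < length ts" "l < length ts" for k l
  proof -
    have "?f (ts ! k) \<inter> ?f (ts ! l) = z ` (set (ts ! k) \<inter> set (ts ! l))"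
      using inj_on_image_Int[OF inj T(2) T(2)] that by simp
    then show ?thesis using meet'[OF that] card_image_le[of "set (ts ! k) \<inter> set (ts ! l)" z] by simp
  qed
  have card3: "card (?f T) = 3" if "T \<in> set ts" for T
    using card_image[OF inj_on_subset[OF inj T(2)[OF that]]] T(1)[OF that] by simp
  \<comment> \<open>Two positions with the same image would give a triangle meeting itself in at
    most one vertex. So no triangle is counted twice.\<close>
  have "inj_on (\<lambda>k. ?f (ts ! k)) {..<length ts}"
  proof (rule inj_onI, rule ccontr)
    fix k l assume kl: "k \<in> {..<length ts}" "l \<in> {..<length ts}" "?f (ts ! k) = ?f (ts ! l)" "k \<noteq> l"
    with f_meet[of k l] have "card (?f (ts ! k)) \<le> 1" by simp
    with card3[of "ts ! k"] kl show False by simp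
  qed
  then have "card ((\<lambda>k. ?f (ts ! k)) ` {..<length ts}) = length ts" by (simp add: card_image)
  moreover have im: "(\<lambda>k. ?f (ts ! k)) ` {..<length ts} = ?f ` set ts"
    by (force simp: set_conv_nth)
  ultimately show "card (?f ` set ts) = length ts" by simp
  show "edge_disjoint (?f ` set ts)"
  proof (rule edge_disjointI)
    fix A B assume "A \<in> ?f ` set ts" "B \<in> ?f ` set ts" "A \<noteq> B"
    then obtain k l where "k < length ts" "l < length ts" "A = ?f (ts ! k)" "B = ?f (ts ! l)"
      unfolding im[symmetric] by blast
    moreover from this \<open>A \<noteq> B\<close> have "k \<noteq> l" by auto
    ultimately show "finite A \<and> card (A \<inter> B) \<le> 1" using f_meet by simp
  qed
  show "\<And>A. A \<in> ?f ` set ts \<Longrightarrow> A \<subseteq> z ` {..<8}" using T(2) by fast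
  have edge: "{z i, z j} \<in> E" if "T \<in> set ts" "i \<in> set T" "j \<in> set T" "i < j" for T i j
  proof -
    have "i < 8" "j < 8" using T(2)[OF that(1)] that(2,3) by auto
    then consider "j < 6" | "j = 6" "i < 6" | "j = 7" "i < 6" | "i = 6" "j = 7"
      using \<open>i < j\<close> by linarith
    then show ?thesis
      using that outer by cases (auto intro!: inner simp: mem_inner_edges)
  qed
  show "?f ` set ts \<subseteq> triangles E"
  proof
    fix A assume "A \<in> ?f ` set ts"
    then obtain T where A: "A = ?f T" "T \<in> set ts" by auto
    have "e \<in> E" if e: "e \<in> triangle_edges A" for e
    proof -
      obtain a b where ab: "e = {a, b}" "a \<noteq> b" "a \<in> ?f T" "b \<in> ?f T"
        using e A by (auto simp: triangle_edges_def card_2_iff)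
      then obtain i j where "a = z i" "i \<in> set T" "b = z j" "j \<in> set T" by blast
      moreover from this ab have "i \<noteq> j" by auto
      ultimately show ?thesis
        using edge[OF A(2), of i j] edge[OF A(2), of j i]
        by (cases "i < j") (auto simp: ab insert_commute)
    qed
    then show "A \<in> triangles E" using card3 A by (auto simp: triangles_def)
  qed
qed

text \<open>Here 2m is the number of edges and d the degree of label 0. Pairs at 0 are known, so
  only the pairs of nonzero labels enter the search.\<close>

definition covering :: "nat \<Rightarrow> nat \<Rightarrow> nat list list list \<Rightarrow> bool" where
  "covering m d C \<longleftrightarrow>
     list_all (\<lambda>ts. packing ts \<and> length ts = Suc m \<and>
       list_all (\<lambda>(i, j). i = 0 \<longrightarrow> j \<le> d) (inner_edges ts)) C \<and>
     unavoidable (10 + d - 2 * m) (map (\<lambda>ts. filter (\<lambda>(i, j). i \<noteq> 0) (inner_edges ts)) C)"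

section \<open>Configurations by number of triangles\<close>

definition apex :: "nat list list" where
  "apex = [[0,6,7]]"

definition edge :: "nat list list" where
  "edge = [[0,1,6], [2,6,7]]"

text \<open>The numeral counts vertices. Consecutive edges go alternately to 6 and 7, and a label
  off the path completes a triangle with 6 and 7.\<close>

definition path3 :: "nat list list" where
  "path3 = [[0,1,6], [1,2,7], [3,6,7]]"

definition edge_edge :: "nat list list" where
  "edge_edge = [[0,1,6], [2,3,7], [4,6,7]]"

definition path4 :: "nat list list" where
  "path4 = [[0,1,6], [1,2,7], [2,3,6], [4,6,7]]"

definition path3_edge :: "nat list list" where
  "path3_edge = [[0,1,6], [1,2,7], [3,4,7], [5,6,7]]"

definition four_cycle :: "nat list list" where
  "four_cycle = [[0,1,6], [1,2,7], [2,3,6], [3,0,7], [4,6,7]]"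

definition four_cycle_triangle :: "nat list list" where
  "four_cycle_triangle = four_cycle @ [[0,2,4]]"

text \<open>Two perfect matchings give six triangles and leave no label free for a triangle through
  6 and 7.\<close>

definition six_cycle :: "nat list list" where
  "six_cycle = [[0,1,6], [1,2,7], [2,3,6], [3,4,7], [4,5,6], [5,0,7]]"

definition six_cycle_triangle :: "nat list list" where
  "six_cycle_triangle = six_cycle @ [[0,2,4]]"

definition six_cycle_triangles :: "nat list list" where
  "six_cycle_triangles = six_cycle @ [[0,2,4], [1,3,5]]"

section \<open>The finite check\<close>

text \<open>\<open>apex\<close> has no inner edge, and no set meets an empty member.\<close>

lemma covering_0_0: "covering 0 0 (
    map (relabel apex)
      [[2,5,4,3,1,0]])"
  by code_simp

lemma covering_1_0: "covering 1 0 (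
    map (relabel edge)
      [[2,3,4,0,1,5], [2,1,3,0,5,4], [5,4,1,0,2,3], [5,1,4,3,2,0], [5,3,2,4,0,1],
       [4,2,0,3,1,5], [2,5,1,3,0,4], [3,1,4,2,0,5], [3,4,0,2,1,5]])"
  by code_simp

lemma covering_2_0: "covering 2 0 (
    map (relabel path3)
      [[5,3,2,4,1,0]] @
    map (relabel edge_edge)
      [[5,4,3,2,0,1]] @
    map (relabel path3)
      [[4,5,3,1,2,0], [2,5,3,4,0,1]] @
    map (relabel edge_edge)
      [[2,4,3,5,0,1], [4,5,2,1,0,3]] @
    map (relabel path3)
      [[4,5,2,1,3,0], [5,3,1,2,0,4], [2,1,5,4,3,0], [1,5,4,0,3,2], [1,2,5,0,3,4],
       [4,2,3,5,0,1], [2,4,1,0,5,3], [2,4,3,0,1,5]] @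
    map (relabel edge_edge)
      [[1,4,2,3,5,0]] @
    map (relabel path3)
      [[1,4,3,2,5,0], [1,3,4,2,5,0], [3,1,5,4,0,2], [5,2,3,1,0,4]])"
  by code_simp

lemma covering_2_1: "covering 2 1 (
    map (relabel path3)
      [[0,1,3,5,2,4]] @
    map (relabel edge_edge)
      [[1,0,3,4,2,5], [0,1,3,2,4,5], [2,4,0,1,3,5]] @
    map (relabel path3)
      [[0,1,4,2,3,5]] @
    map (relabel edge_edge)
      [[5,3,0,1,2,4]] @
    map (relabel path3)
      [[2,1,0,5,4,3], [5,1,0,3,2,4]])"
  by code_simp

lemma covering_3_0: "covering 3 0 (
    map (relabel path4)
      [[5,2,1,4,3,0], [3,1,2,5,0,4], [1,4,2,5,3,0], [4,5,2,1,0,3], [3,5,1,2,4,0],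
       [2,5,4,1,3,0], [3,1,5,2,4,0], [4,3,5,1,0,2], [5,3,1,4,0,2], [4,3,1,2,5,0],
       [5,4,3,1,2,0], [5,3,4,2,1,0], [4,5,3,2,0,1]] @
    map (relabel path3_edge)
      [[4,3,2,1,5,0]] @
    map (relabel path4)
      [[4,5,1,2,3,0], [1,4,2,3,0,5]])"
  by code_simp

lemma covering_3_1: "covering 3 1 (
    map (relabel path3_edge)
      [[3,2,4,1,0,5], [0,1,5,2,3,4], [0,1,4,2,3,5], [2,1,0,4,5,3], [2,1,0,4,3,5]] @
    map (relabel path4)
      [[4,2,1,0,5,3]] @
    map (relabel path3_edge)
      [[0,1,5,4,2,3], [2,1,0,3,5,4]] @
    map (relabel path4)
      [[0,1,5,2,4,3]] @
    map (relabel path3_edge)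
      [[3,5,2,1,0,4]] @
    map (relabel path4)
      [[0,1,3,5,2,4], [0,1,3,4,2,5], [5,4,1,0,2,3]])"
  by code_simp

lemma covering_3_2: "covering 3 2 (
    map (relabel path3_edge)
      [[1,0,2,4,3,5]] @
    map (relabel path4)
      [[5,1,0,2,3,4]] @
    map (relabel path3_edge)
      [[2,0,1,5,4,3]] @
    map (relabel path4)
      [[2,0,1,4,3,5], [3,1,0,2,4,5], [3,2,0,1,5,4], [4,2,0,1,3,5]])"
  by code_simp

lemma covering_4_0: "covering 4 0 (
    map (relabel four_cycle)
      [[4,2,1,3,0,5], [4,5,3,2,1,0], [5,2,1,4,3,0], [2,3,1,5,0,4], [3,5,1,4,2,0]])"
  by code_simp

lemma covering_4_1: "covering 4 1 (
    map (relabel four_cycle)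
      [[2,4,1,3,0,5], [2,4,1,5,3,0], [2,1,3,4,5,0], [4,2,1,5,0,3], [2,1,4,3,0,5],
       [4,1,2,5,0,3], [3,1,2,5,0,4], [4,1,5,3,2,0], [5,4,1,3,0,2], [5,1,2,3,4,0],
       [4,2,3,5,0,1], [5,1,3,2,0,4], [3,4,5,1,2,0]])"
  by code_simp

lemma covering_4_2: "covering 4 2 (
    map (relabel four_cycle)
      [[5,2,0,1,4,3], [0,1,4,2,3,5], [2,1,4,5,0,3], [1,3,2,0,4,5], [1,2,3,4,0,5],
       [5,2,3,4,0,1], [5,2,1,3,0,4], [3,1,2,4,5,0], [4,5,3,1,2,0], [3,4,1,5,0,2],
       [3,5,2,4,0,1], [2,4,5,3,0,1], [1,3,4,5,2,0], [5,3,2,1,4,0], [5,1,2,4,3,0]])"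
  by code_simp

lemma covering_5_0: "covering 5 0 (
    map (relabel four_cycle_triangle)
      [[1,2,5,3,4,0]])"
  by code_simp

lemma covering_5_1: "covering 5 1 (
    map (relabel four_cycle_triangle)
      [[2,3,1,5,4,0], [1,2,3,4,5,0], [5,3,4,1,2,0], [3,1,2,4,5,0]])"
  by code_simp

lemma covering_5_2: "covering 5 2 (
    map (relabel six_cycle)
      [[5,4,3,1,0,2], [1,5,4,3,2,0], [4,5,3,1,0,2], [1,5,3,4,2,0], [2,0,1,4,3,5],
       [4,1,0,2,3,5]] @
    map (relabel four_cycle_triangle)
      [[1,0,2,5,4,3]])"
  by code_simp

lemma covering_5_3: "covering 5 3 (
    map (relabel six_cycle)
      [[5,4,2,0,1,3], [5,3,0,1,2,4], [1,3,0,2,4,5], [5,3,0,2,4,1], [2,4,1,0,3,5],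
       [3,0,2,5,4,1], [0,3,2,5,4,1], [2,4,3,5,1,0], [0,2,1,4,5,3], [1,0,3,4,5,2],
       [2,0,1,5,4,3], [5,2,0,1,4,3], [1,5,2,0,3,4]] @
    map (relabel four_cycle_triangle)
      [[2,0,1,3,5,4], [2,0,3,1,4,5], [1,0,3,2,5,4]])"
  by code_simp

lemma covering_6_2: "covering 6 2 (
    map (relabel six_cycle_triangle)
      [[5,4,2,0,1,3]])"
  by code_simp

lemma covering_6_3: "covering 6 3 (
    map (relabel six_cycle_triangle)
      [[1,3,5,4,2,0], [5,2,3,0,1,4], [3,5,1,0,2,4], [4,1,3,0,2,5], [2,0,3,5,4,1]])"
  by code_simp

lemma covering_6_4: "covering 6 4 (
    map (relabel six_cycle_triangle)
      [[3,4,0,1,2,5], [0,1,2,5,4,3], [0,4,3,5,1,2], [4,5,1,2,0,3], [4,2,0,1,3,5],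
       [1,4,0,3,2,5], [4,1,0,3,2,5], [3,5,2,4,0,1], [1,5,3,2,0,4], [4,2,0,3,1,5]])"
  by code_simp

text \<open>Fourteen of the fifteen pairs are edges; the missing pair 0, 5 is placed opposite on the
  six-cycle, so neither the cycle nor its two triangles use it.\<close>

lemma covering_7_4: "covering 7 4 (
    map (relabel six_cycle_triangles)
      [[1,2,5,4,3,0]])"
  by code_simp
lemma covering_exists:
  assumes "3 * d \<le> 2 * m" "2 * m \<le> 10 + d"
  shows "\<exists>C. covering m d C"
proof -
  have all: "\<forall>(m, d)\<in>
    {(0, 0), (1, 0), (2, 0), (2, 1), (3, 0), (3, 1), (3, 2), (4, 0), (4, 1), (4, 2), (5,
     0), (5, 1), (5, 2), (5, 3), (6, 2), (6, 3), (6, 4), (7, 4)}. \<exists>C. covering m d C"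
    unfolding ball_simps prod.case
    by (intro conjI TrueI; rule exI,
        rule covering_0_0 covering_1_0 covering_2_0 covering_2_1 covering_3_0 covering_3_1
          covering_3_2 covering_4_0 covering_4_1 covering_4_2 covering_5_0 covering_5_1
          covering_5_2 covering_5_3 covering_6_2 covering_6_3 covering_6_4 covering_7_4)
  \<comment> \<open>The assumptions give d \<le> 5, and d = 5 would force 2m = 15. Hence d \<le> 4
    and m \<le> 7.\<close>
  have "m \<in> {0, 1, 2, 3, 4, 5, 6, 7}" "d \<in> {0, 1, 2, 3, 4}"
    using assms by (simp_all, presburger+)
  then have "(m, d) \<in>
    {(0, 0), (1, 0), (2, 0), (2, 1), (3, 0), (3, 1), (3, 2), (4, 0), (4, 1), (4, 2), (5,
     0), (5, 1), (5, 2), (5, 3), (6, 2), (6, 3), (6, 4), (7, 4)}"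
    using assms by (elim insertE emptyE; simp)
  from bspec[OF all this] show ?thesis by simp
qed

section \<open>Graphs on six vertices\<close>

text \<open>The six degrees sum to 4m, so the least is at most 2m/3.\<close>

lemma exists_low_degree:
  assumes "finite W" "card W = 6" and H: "finite H" "\<And>e. e \<in> H \<Longrightarrow> e \<subseteq> W \<and> card e = 2"
    and "card H = 2 * m"
  obtains x where "x \<in> W" "3 * card {e \<in> H. x \<in> e} \<le> 2 * m"
proof (rule ccontr)
  assume "\<not> thesis"
  with that have "2 * m + 1 \<le> 3 * card {e \<in> H. x \<in> e}" if "x \<in> W" for x using that by force
  then have "(\<Sum>x\<in>W. 2 * m + 1) \<le> (\<Sum>x\<in>W. 3 * card {e \<in> H. x \<in> e})" by (rule sum_mono)
  moreover have "(\<Sum>x\<in>W. card {e \<in> H. x \<in> e}) = 2 * card H"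
  proof (rule sum_multicount)
    have "{x \<in> W. x \<in> e} = e" if "e \<in> H" for e using H(2)[OF that] by auto
    then show "\<forall>e\<in>H. card {x \<in> W. x \<in> e} = 2" using H(2) by simp
  qed (use assms in auto)
  ultimately show False using assms by (simp add: sum_distrib_left[symmetric])
qed

lemma exists_packing:
  assumes W: "finite W" "card W = 6" and H: "\<And>e. e \<in> H \<Longrightarrow> e \<subseteq> W \<and> card e = 2"
    and m: "card H = 2 * m"
  obtains ts zs where "packing ts" "length ts = Suc m" "distinct zs" "set zs = W"
    "\<And>i j. (i, j) \<in> set (inner_edges ts) \<Longrightarrow> {zs ! i, zs ! j} \<in> H"
proof -
  have finH: "finite H" using H W by (auto intro: finite_subset[of H "Pow W"])
  obtain x where x: "x \<in> W" "3 * card {e \<in> H. x \<in> e} \<le> 2 * m"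
    using exists_low_degree[OF W finH H m] by metis
  define d where "d = card {e \<in> H. x \<in> e}"
  define A where "A = {y. {x, y} \<in> H}"
  have xA: "x \<notin> A" using H[of "{x, x}"] by (auto simp: A_def)
  have AW: "A \<subseteq> W" using H by (force simp: A_def)
  have "{e \<in> H. x \<in> e} = (\<lambda>y. {x, y}) ` A"
  proof -
    have "e \<in> (\<lambda>y. {x, y}) ` A" if e: "e \<in> H" "x \<in> e" for e
    proof -
      obtain a b where "e = {a, b}" using H[OF e(1)] unfolding card_2_iff by blast
      with e(2) have "e = {x, a} \<or> e = {x, b}" by blast
      then show ?thesis using e(1) unfolding A_def by blast
    qed
    then show ?thesis by (auto simp: A_def)
  qed
  moreover have "inj_on (\<lambda>y. {x, y}) A" by (auto simp: inj_on_def doubleton_eq_iff)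
  ultimately have cA: "card A = d" by (simp add: card_image d_def)
  obtain ns os where ns: "set ns = A" "distinct ns" and os: "set os = W - {x} - A" "distinct os"
    using finite_distinct_list[OF finite_subset[OF AW W(1)]] finite_distinct_list[of "W - {x} - A"] W
    by blast
  \<comment> \<open>The vertex x gets label 0, its neighbours the labels 1 to d, and the
    non-neighbours the rest.\<close>
  define zs where "zs = x # ns @ os"
  have zs: "distinct zs" "set zs = W" using ns os xA AW x by (auto simp: zs_def)
  then have len: "length zs = 6" using W distinct_card by fastforce
  have lns: "length ns = d" using ns cA distinct_card by fastforce
  have z0: "{zs ! 0, zs ! j} \<in> H" if "0 < j" "j \<le> d" for j
  proof -
    have "zs ! j \<in> A" using that ns lns by (auto simp: zs_def nth_Cons' nth_append)
    then show ?thesis by (simp add: A_def zs_def)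
  qed
  define P where "P = (SIGMA i:{1..<6}. {i<..<6::nat})"
  define N where "N = {(i, j) \<in> P. {zs ! i, zs ! j} \<notin> H}"
  have cP: "card P = 10" "finite P" by (simp_all add: P_def numeral_eq_Suc)
  have NP: "N \<subseteq> P" by (auto simp: N_def)
  then have finN: "finite N" using cP finite_subset by blast
  \<comment> \<open>The 2m - d edges missing x are among the pairs of \<open>P\<close> outside
    \<open>N\<close>, which bounds the number of non-edges.\<close>
  have "{e \<in> H. x \<notin> e} \<subseteq> (\<lambda>(i, j). {zs ! i, zs ! j}) ` (P - N)"
  proof
    fix e assume e: "e \<in> {e \<in> H. x \<notin> e}"
    then obtain a b where ab: "e = {a, b}" "a \<noteq> b" using H[of e] by (auto simp: card_2_iff)
    moreover have "a \<in> set zs" "b \<in> set zs" using e ab H zs by auto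
    ultimately obtain i j where ij: "a = zs ! i" "b = zs ! j" "i < 6" "j < 6" "i \<noteq> j"
      using len by (metis in_set_conv_nth)
    have "1 \<le> i" "1 \<le> j" using e ab ij by (auto simp: zs_def Suc_le_eq intro: gr0I)
    then show "e \<in> (\<lambda>(i, j). {zs ! i, zs ! j}) ` (P - N)"
    proof (intro image_eqI)
      show "e = (case (min i j, max i j) of (i, j) \<Rightarrow> {zs ! i, zs ! j})"
        using ab ij by (simp add: min_def max_def insert_commute)
      then show "(min i j, max i j) \<in> P - N"
        using e ij \<open>1 \<le> i\<close> \<open>1 \<le> j\<close>
        by (auto simp: P_def N_def min_def max_def split: if_splits)
    qed
  qed
  then have "card {e \<in> H. x \<notin> e} \<le> card (P - N)"
    using cP by (meson card_image_le card_mono finite_Diff finite_imageI le_trans)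
  moreover have "card {e \<in> H. x \<notin> e} + d = 2 * m"
  proof -
    have "{e \<in> H. x \<notin> e} = H - {e \<in> H. x \<in> e}" by auto
    then show ?thesis
      using finH m card_mono[of H "{e \<in> H. x \<in> e}"] by (simp add: card_Diff_subset d_def)
  qed
  moreover have "card (P - N) + card N = 10"
    using NP cP card_mono[OF cP(2) NP] card_Diff_subset[OF finN NP] by simp
  ultimately have b: "card N \<le> 10 + d - 2 * m" "2 * m \<le> 10 + d" by linarith+
  obtain C where C: "covering m d C"
    using covering_exists[of d m] b x by (auto simp: d_def)
  obtain ts where ts: "ts \<in> set C" "set (filter (\<lambda>(i, j). i \<noteq> 0) (inner_edges ts)) \<inter> N = {}"
    using unavoidable_avoids[OF _ finN b(1)] C unfolding covering_def by force
  have "{zs ! i, zs ! j} \<in> H" if ij: "(i, j) \<in> set (inner_edges ts)" for i j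
  proof (cases "i = 0")
    case True
    have "j \<le> d" using C ts ij True by (auto simp: covering_def list_all_iff)
    moreover have "0 < j" using ij True by (simp add: mem_inner_edges)
    ultimately show ?thesis using z0 True by blast
  next
    case False
    then have "(i, j) \<notin> N" using ts ij by auto
    moreover have "(i, j) \<in> P" using ij False by (auto simp: P_def mem_inner_edges)
    ultimately show ?thesis by (auto simp: N_def)
  qed
  then show thesis
    using that[of ts zs] zs C ts by (auto simp: covering_def list_all_iff)
qed

section \<open>Reduction to the common neighbourhood\<close>

theorem proposition7p3:
  fixes V :: "'a set" and E :: "'a set set" and u v :: 'a
  assumes "regular_graph 7 V E"
    and "{u, v} \<in> E"
    and "card (nbhd E u \<inter> nbhd E v) = 6"
  shows "reducible V E {u, v}"
proof -
  have V: "finite V" and E: "\<And>e. e \<in> E \<Longrightarrow> e \<subseteq> V \<and> card e = 2"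
    and reg: "\<And>x. x \<in> V \<Longrightarrow> card (nbhd E x) = 7"
    using assms(1) by (auto simp: regular_graph_def simple_graph_def)
  define W where "W = nbhd E u \<inter> nbhd E v"
  have W: "finite W" "card W = 6" using assms(3) by (auto simp: W_def intro: card_ge_0_finite)
  have irrefl: "{x, x} \<notin> E" for x using E[of "{x, x}"] by auto
  have uv: "u \<in> V" "v \<in> V" "u \<noteq> v" "u \<notin> W" "v \<notin> W"
    using E[OF assms(2)] irrefl assms(2) by (auto simp: W_def nbhd_def)
  \<comment> \<open>By regularity, six common neighbours and the other end of the edge exhaust the
    neighbourhood.\<close>
  have nbhd_eq: "nbhd E x = insert y W"
    if "x \<in> V" "{x, y} \<in> E" "y \<notin> W" "W \<subseteq> nbhd E x" for x y
  proof (rule card_subset_eq[symmetric])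
    show "finite (nbhd E x)" using reg[OF that(1)] by (simp add: card_ge_0_finite)
  qed (use that W reg in \<open>auto simp: nbhd_def\<close>)
  have nbhd_uv: "nbhd E u = insert v W" "nbhd E v = insert u W"
    using nbhd_eq[of u v] nbhd_eq[of v u] assms(2) uv by (auto simp: W_def insert_commute)
  define H where "H = {e \<in> E. e \<subseteq> W}"
  have finH: "finite H" using W by (auto simp: H_def intro: finite_subset[of _ "Pow W"])
  \<comment> \<open>Rounding down is affordable: m + 1 triangles pay for 2m + 2 deletions, at least
    1 + |H|.\<close>
  define m where "m = card H div 2"
  obtain H' where H': "H' \<subseteq> H" "card H' = 2 * m"
    using obtain_subset_with_card_n[of "2 * m" H] by (metis m_def times_div_less_eq_dividend)
  obtain ts zs where ts: "packing ts" "length ts = Suc m" "distinct zs" "set zs = W"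
    "\<And>i j. (i, j) \<in> set (inner_edges ts) \<Longrightarrow> {zs ! i, zs ! j} \<in> H'"
  proof (rule exists_packing[OF W _ H'(2)])
    show "e \<subseteq> W \<and> card e = 2" if "e \<in> H'" for e using that H'(1) E by (auto simp: H_def)
  qed (rule that)
  have len: "length zs = 6" using ts W distinct_card by fastforce
  let ?ys = "zs @ [u, v]"
  have range: "(!) ?ys ` {..<8} = W \<union> {u, v}"
  proof -
    have "(!) ?ys ` {..<8} = set ?ys" using len by (auto simp: set_conv_nth)
    then show ?thesis using ts by auto
  qed
  have ys: "?ys ! 6 = u" "?ys ! 7 = v" "\<And>i. i < 6 \<Longrightarrow> ?ys ! i = zs ! i" "\<And>i. i < 6 \<Longrightarrow> zs ! i \<in> W"
    using len ts(4) by (auto simp: nth_append)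
  obtain S where S: "S \<subseteq> triangles E" "edge_disjoint S" "card S = length ts"
    "\<And>T. T \<in> S \<Longrightarrow> T \<subseteq> (!) ?ys ` {..<8}"
  proof (rule packing_triangles[OF ts(1), of "(!) ?ys" E])
    show "inj_on ((!) ?ys) {..<8}" using ts uv len by (auto intro!: inj_on_nth)
    show "{?ys ! i, ?ys ! j} \<in> E" if "(i, j) \<in> set (inner_edges ts)" for i j
      using ts(5)[OF that] that ys H' by (auto simp: mem_inner_edges H_def)
  qed (use ys assms(2) in \<open>auto simp: W_def nbhd_def insert_commute\<close>)
  \<comment> \<open>All of \<open>H\<close> is deleted, including an edge dropped in passing to
    \<open>H'\<close>.\<close>
  define X where "X = insert {u, v} H"
  have "card X \<le> 2 * card S"
  proof -
    have "card X \<le> Suc (card H)" using finH by (simp add: X_def card_insert_if)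
    also have "\<dots> \<le> 2 * Suc m" using div_mult_mod_eq[of "card H" 2] by (simp add: m_def)
    finally show ?thesis using S ts by simp
  qed
  moreover have "T \<inter> {u, v} = {}" if T: "T \<in> triangles (E - X)" for T
  proof (rule ccontr)
    assume "T \<inter> {u, v} \<noteq> {}"
    then obtain x where x: "x \<in> T" "x \<in> {u, v}" by auto
    have edges: "{y, z} \<in> E - X" if "y \<in> T" "z \<in> T" "y \<noteq> z" for y z
    proof -
      have "{y, z} \<in> triangle_edges T" using that by (simp add: triangle_edges_def)
      then show ?thesis using T unfolding triangles_def by blast
    qed
    have "card T = 3" using T by (simp add: triangles_def)
    then have "card (T - {x}) = 2" using x by simp
    then obtain y z where yz: "T - {x} = {y, z}" "y \<noteq> z" unfolding card_2_iff by blast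
    then have yzT: "y \<in> T" "z \<in> T" "y \<noteq> x" "z \<noteq> x" by blast+
    \<comment> \<open>With uv deleted, the other two vertices of \<open>T\<close> lie in
      \<open>W\<close>, so the edge joining them is in \<open>H\<close>.\<close>
    have "w \<in> W" if "w \<in> T" "w \<noteq> x" for w
    proof -
      have xw: "w \<in> nbhd E x" "{x, w} \<noteq> {u, v}"
        using edges[of x w] x(1) that by (simp_all add: nbhd_def X_def)
      from x(2) consider "x = u" | "x = v" by blast
      then show ?thesis
        using xw nbhd_uv by cases (simp_all add: insert_commute, blast+)
    qed
    with yzT have "y \<in> W" "z \<in> W" by auto
    moreover have "{y, z} \<in> E - X" using edges yzT(1,2) yz(2) .
    ultimately show False unfolding X_def H_def by blast
  qed
  moreover have "e \<in> X" if "e \<in> S_edges S" "e \<inter> {u, v} = {}" for e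
  proof -
    obtain T where "T \<in> S" "e \<in> triangle_edges T" using \<open>e \<in> S_edges S\<close> by (auto simp: S_edges_def)
    moreover from this have "e \<in> E" using S(1) by (auto simp: triangles_def)
    moreover have "e \<subseteq> W \<union> {u, v}"
      using \<open>e \<in> triangle_edges T\<close> S(4)[OF \<open>T \<in> S\<close>] range by (auto simp: triangle_edges_def)
    ultimately show ?thesis using that by (auto simp: X_def H_def)
  qed
  moreover have "X \<subseteq> E" using assms(2) by (auto simp: X_def H_def)
  ultimately show ?thesis using S uv unfolding reducible_def by blast
qed

end
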